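(* For every integer $n\ge3$ there is a nonempty open cone $\mathcal{C}\subseteq\mathbb{R}^{n\times n}$ (i.e. a nonempty open subset of $\mathbb{R}^{n\times n}$ with $t\mathcal{C}=\mathcal{C}$ for all $t>0$) such that no $A\in\mathcal{C}$ has a real nearest complex normal matrix; that is, for every $A\in\mathcal{C}$, every complex normal matrix $N$ minimizing $\|A-N\|_F$ over all complex normal $n\times n$ matrices is nonreal.
   Context: A matrix $N\in\mathbb{C}^{n\times n}$ is normal if $NN^*=N^*N$. $\|\cdot\|_F$ is the Frobenius norm. *)

theory Defs
  imports "HOL-Analysis.Analysis"
begin

definition conj_transpose :: "complex ^ 'n ^ 'm \<Rightarrow> complex ^ 'm ^ 'n" where
  "conj_transpose M = map_matrix cnj (transpose M)"

definition normal_matrix :: "complex ^ 'n ^ 'n \<Rightarrow> bool" where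
  "normal_matrix N \<longleftrightarrow> N ** conj_transpose N = conj_transpose N ** N"

definition frobenius_norm :: "complex ^ 'n ^ 'm \<Rightarrow> real" where
  "frobenius_norm M = sqrt (\<Sum>i\<in>UNIV. \<Sum>j\<in>UNIV. (cmod (M $ i $ j))\<^sup>2)"

text \<open>The norm that the library puts on nested vectors is the Frobenius norm.\<close>

lemma frobenius_norm_eq_norm: "frobenius_norm M = norm M"
  by (simp add: frobenius_norm_def norm_vec_def L2_set_def sum_nonneg)

definition real_matrix :: "complex ^ 'n ^ 'm \<Rightarrow> bool" where
  "real_matrix N \<longleftrightarrow> (\<forall>i j. N $ i $ j \<in> \<real>)"

definition nearest_normal_matrix :: "complex ^ 'n ^ 'n \<Rightarrow> complex ^ 'n ^ 'n \<Rightarrow> bool" where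
  "nearest_normal_matrix A N \<longleftrightarrow> is_arg_min (\<lambda>M. frobenius_norm (A - M)) normal_matrix N"

text \<open>
  The library predicate \<open>cone\<close> demands closure under multiplication by every \<open>t \<ge> 0\<close>, so a nonempty
  cone in that sense contains 0. Here only positive scalars are allowed.
\<close>

definition positive_cone :: "'a::real_vector set \<Rightarrow> bool" where
  "positive_cone C \<longleftrightarrow> (\<forall>t>0. (\<lambda>x. t *\<^sub>R x) ` C = C)"

end

theory Submission
  imports Defs
begin

text \<open>
  It suffices to find one real matrix with a complex normal matrix strictly closer to it than every
  real normal matrix: both conditions persist under small perturbations and positive scaling.

  For size 3 take 8 times the matrix with rows (2,1,0), (-1,0,1), (0,-1,-2). A real normal matrix is
  either symmetric or of the form \<open>\<alpha> I + \<gamma> w w\<^sup>T + [w]\<^sub>\<times>\<close>, where \<open>[w]\<^sub>\<times>\<close> is the matrix of the cross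
  product with \<open>w\<close>, and completing squares bounds its squared distance below by 736/3; an explicit
  complex normal matrix is at squared distance 242.

  For larger sizes add a diagonal block \<open>T I\<close> with \<open>T\<close> large. If real normal matrices stay within
  bounded distance of this sum as \<open>T\<close> tends to infinity, normality forces the antisymmetric part of
  the off-diagonal blocks to vanish in the limit, so their compressions to the first block
  accumulate at a real normal matrix, to which the bound for size 3 applies.
\<close>

section \<open>Real normal matrices of size 3: the lower bound\<close>

text \<open>The right-hand side is the squared distance in \<open>dist_A3_real_normal\<close> below, where (a,b,c)
  represents the skew part and \<open>\<alpha> I + \<gamma> w w\<^sup>T\<close> the symmetric part.\<close>

lemma sqdist_axial_ge:
  fixes a b c p q r s t u :: real
  assumes nz: "a\<^sup>2 + b\<^sup>2 + c\<^sup>2 > 0"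
    and "p = \<alpha> + \<gamma> * a\<^sup>2" "s = \<alpha> + \<gamma> * b\<^sup>2" "u = \<alpha> + \<gamma> * c\<^sup>2"
    and "q = \<gamma> * a * b" "r = \<gamma> * a * c" "t = \<gamma> * b * c"
  shows "736/3 \<le> (16 - p)\<^sup>2 + s\<^sup>2 + (16 + u)\<^sup>2 + 2 * q\<^sup>2 + 2 * r\<^sup>2 + 2 * t\<^sup>2
    + 2 * (8 + c)\<^sup>2 + 2 * b\<^sup>2 + 2 * (8 + a)\<^sup>2" (is "_ \<le> ?D")
proof -
  define m where "m = a\<^sup>2 + b\<^sup>2 + c\<^sup>2"
  \<comment> \<open>\<open>T\<close> and \<open>x\<close> depend only on the direction of (a,b,c),
    which stays fixed while \<alpha>, \<gamma> and the length of (a,b,c) are optimised.\<close>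
  define T where "T = (a + c)\<^sup>2 / m"
  define x where "x = (a\<^sup>2 - c\<^sup>2) / m"
  have m: "m > 0" using nz by (simp add: m_def)
  have "(a - c)\<^sup>2 + (a + c)\<^sup>2 \<le> 2 * m"
    by (simp add: m_def power2_eq_square algebra_simps)
  then have "((a - c)\<^sup>2 + (a + c)\<^sup>2) / m \<le> 2"
    using m by (simp add: divide_le_eq)
  then have "(a - c)\<^sup>2 / m \<le> 2 - T"
    by (simp add: T_def add_divide_distrib)
  moreover have "T \<ge> 0" using m by (simp add: T_def)
  moreover have "x\<^sup>2 = T * ((a - c)\<^sup>2 / m)"
    by (simp add: x_def T_def power_divide square_diff_square_factored power_mult_distrib power2_eq_square)
  ultimately have Q: "x\<^sup>2 \<le> T * (2 - T)"
    using mult_left_mono by metis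
  have xm: "a\<^sup>2 - c\<^sup>2 = x * m" using m by (simp add: x_def)
  have Tm: "2 * (m + 8 * (a + c))\<^sup>2 / m = 2 * m + 32 * (a + c) + 128 * T"
    using m by (simp add: T_def field_simps power2_eq_square)
  have "?D = 768 + 3 * \<alpha>\<^sup>2 + 2 * \<alpha> * \<gamma> * m + \<gamma>\<^sup>2 * m\<^sup>2 - 32 * \<gamma> * (a\<^sup>2 - c\<^sup>2) + 32 * (a + c) + 2 * m"
    unfolding assms m_def by algebra
  \<comment> \<open>Squares are completed in \<alpha>, in \<open>\<gamma> * m\<close> and in the
    length \<open>sqrt m\<close>; the remainder is a function of the direction alone.\<close>
  also have "\<dots> = 768 + 3 * (\<alpha> + \<gamma> * m / 3)\<^sup>2 + (2/3) * (\<gamma> * m - 24 * x)\<^sup>2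
      + 2 * (m + 8 * (a + c))\<^sup>2 / m - 384 * x\<^sup>2 - 128 * T"
    unfolding xm Tm by (simp add: power2_eq_square algebra_simps)
  finally have D: "?D = \<dots>" .
  have "2 * (m + 8 * (a + c))\<^sup>2 / m \<ge> 0" "3 * (\<alpha> + \<gamma> * m / 3)\<^sup>2 \<ge> 0"
    "(2/3) * (\<gamma> * m - 24 * x)\<^sup>2 \<ge> 0"
    using m by simp_all
  then have "?D \<ge> 768 - 384 * x\<^sup>2 - 128 * T"
    unfolding D by linarith
  \<comment> \<open>After \<open>Q\<close> only a quadratic in \<open>T\<close> remains; its
    minimum, at 7/6, is the constant 736/3.\<close>
  moreover have "768 - 384 * (T * (2 - T)) - 128 * T = 384 * (T - 7/6)\<^sup>2 + 736/3"
    by (simp add: power2_eq_square algebra_simps)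
  moreover have "384 * (T - 7/6)\<^sup>2 \<ge> 0" by simp
  ultimately show ?thesis using Q by linarith
qed

text \<open>The hypotheses say that the symmetric matrix with rows (p,q,r), (q,s,t), (r,t,u) commutes with the
  cross product by (a,b,c).\<close>

lemma commute_cross_axial:
  fixes a b c p q r s t u :: real
  assumes "a\<^sup>2 + b\<^sup>2 + c\<^sup>2 > 0"
    and "q * c = r * b" "t * a = q * c"
    and "r * a + s * c = p * c + t * b" "p * b + t * c = q * a + u * b" "q * b + u * a = s * a + r * c"
  obtains \<alpha> \<gamma> where "p = \<alpha> + \<gamma> * a\<^sup>2" "s = \<alpha> + \<gamma> * b\<^sup>2" "u = \<alpha> + \<gamma> * c\<^sup>2"
    "q = \<gamma> * a * b" "r = \<gamma> * a * c" "t = \<gamma> * b * c"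
proof -
  define m where "m = a\<^sup>2 + b\<^sup>2 + c\<^sup>2"
  \<comment> \<open>For S = \<alpha> I + \<gamma> w w^T with w = (a,b,c), the trace is 3 \<alpha> +
    \<gamma> m, and \<open>f\<close>, which is w^T S w, equals \<alpha> m + \<gamma> m^2. Solving
    these two equations gives \<open>g\<close> = 2 \<gamma> m^2 and \<open>h\<close> = 2 \<alpha>
    m.\<close>
  define f where "f = p * a\<^sup>2 + s * b\<^sup>2 + u * c\<^sup>2 + 2 * q * a * b + 2 * r * a * c + 2 * t * b * c"
  define g where "g = 3 * f - m * (p + s + u)"
  define h where "h = m * (p + s + u) - f"
  have e: "2 * m\<^sup>2 * q = g * a * b" "2 * m\<^sup>2 * r = g * a * c" "2 * m\<^sup>2 * t = g * b * c"
    "2 * m\<^sup>2 * p = h * m + g * a\<^sup>2" "2 * m\<^sup>2 * s = h * m + g * b\<^sup>2"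
    "2 * m\<^sup>2 * u = h * m + g * c\<^sup>2"
    unfolding g_def h_def f_def m_def using assms(2-6) by algebra+
  have m: "m \<noteq> 0" using assms(1) by (simp add: m_def)
  have k: "x = g / (2 * m\<^sup>2) * y * z" if "2 * m\<^sup>2 * x = g * y * z" for x y z
    using that m by (simp add: field_simps)
  have l: "x = h / (2 * m) + g / (2 * m\<^sup>2) * y" if "2 * m\<^sup>2 * x = h * m + g * y" for x y
    using that m by (simp add: field_simps power2_eq_square)
  show thesis
    by (rule that[OF e(4-6)[THEN l] e(1-3)[THEN k]])
qed

section \<open>The matrix of size 3 and its complex competitor\<close>

definition A3 :: "real ^ 3 ^ 3" where
  "A3 = vector [vector [16, 8, 0], vector [-8, 0, 8], vector [0, -8, -16]]"

text \<open>This is H + i (8 I - H^2/16) for the Hermitian H with rows (12,4i,0), (-4i,0,-4i),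
  (0,4i,-12). A polynomial in a Hermitian matrix is normal.\<close>

definition N3 :: "complex ^ 3 ^ 3" where
  "N3 = vector [vector [12 - 2 * \<i>, 3 + 4 * \<i>, - \<i>], vector [- 3 - 4 * \<i>, 6 * \<i>, 3 - 4 * \<i>],
                vector [- \<i>, - 3 + 4 * \<i>, - 12 - 2 * \<i>]]"

lemma normal_N3: "normal_matrix N3"
  by (simp add: normal_matrix_def N3_def conj_transpose_def map_matrix_def transpose_def
      matrix_matrix_mult_def vec_eq_iff forall_3 sum_3 complex_eq_iff)

lemma norm_square_matrix:
  fixes M :: "'a::real_normed_vector ^ 'n ^ 'm"
  shows "(norm M)\<^sup>2 = (\<Sum>i\<in>UNIV. \<Sum>j\<in>UNIV. (norm (M $ i $ j))\<^sup>2)"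
  by (simp add: norm_vec_def L2_set_def sum_nonneg)

lemma dist_A3_N3: "(norm (map_matrix complex_of_real A3 - N3))\<^sup>2 = 242"
  by (simp add: norm_square_matrix A3_def N3_def map_matrix_def sum_3 cmod_power2)

text \<open>A real matrix is normal exactly when its symmetric and skew parts commute, which is what
  \<open>commute_cross_axial\<close> needs if the skew part is nonzero. The bound exceeds 242, the
  value for \<open>N3\<close>.\<close>

lemma dist_A3_real_normal:
  assumes "P ** transpose P = transpose P ** P"
  shows "736/3 \<le> (norm (A3 - P))\<^sup>2"
proof -
  define a b c where "a = (P$3$2 - P$2$3) / 2" and "b = (P$1$3 - P$3$1) / 2" and "c = (P$2$1 - P$1$2) / 2"
  define p s u q r t where "p = P$1$1" and "s = P$2$2" and "u = P$3$3"
    and "q = (P$1$2 + P$2$1) / 2" and "r = (P$1$3 + P$3$1) / 2" and "t = (P$2$3 + P$3$2) / 2"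
  have P: "P$1$1 = p" "P$2$2 = s" "P$3$3 = u" "P$1$2 = q - c" "P$2$1 = q + c" "P$1$3 = r + b"
    "P$3$1 = r - b" "P$2$3 = t - a" "P$3$2 = t + a"
    by (simp_all add: p_def q_def r_def s_def t_def u_def a_def b_def c_def field_simps)
  have D: "(norm (A3 - P))\<^sup>2 = (16 - p)\<^sup>2 + s\<^sup>2 + (16 + u)\<^sup>2 + 2 * q\<^sup>2 + 2 * r\<^sup>2 + 2 * t\<^sup>2
    + 2 * (8 + c)\<^sup>2 + 2 * b\<^sup>2 + 2 * (8 + a)\<^sup>2"
    unfolding norm_square_matrix by (simp add: A3_def sum_3 P power2_eq_square algebra_simps)
  show ?thesis
  proof (cases "a\<^sup>2 + b\<^sup>2 + c\<^sup>2 > 0")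
    case True
    have "(P ** transpose P)$i$j = (transpose P ** P)$i$j" for i j
      using assms by simp
    note N = this[unfolded matrix_matrix_mult_def transpose_def, simplified, unfolded sum_3]
    \<comment> \<open>The commutator of the two parts is symmetric with trace zero, so five of its
      entries determine it.\<close>
    have "q * c = r * b" using N[of 1 1] unfolding P by algebra
    moreover have "t * a = q * c" using N[of 2 2] unfolding P by algebra
    moreover have "r * a + s * c = p * c + t * b" using N[of 1 2] unfolding P by algebra
    moreover have "p * b + t * c = q * a + u * b" using N[of 1 3] unfolding P by algebra
    moreover have "q * b + u * a = s * a + r * c" using N[of 2 3] unfolding P by algebra
    ultimately show ?thesis
      unfolding D by (rule commute_cross_axial[OF True]) (rule sqdist_axial_ge[OF True])
  next
    case False
    then have "a\<^sup>2 = 0 \<and> b\<^sup>2 = 0 \<and> c\<^sup>2 = 0"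
      by (smt (verit) zero_le_power2)
    then have "a = 0" "b = 0" "c = 0" by simp_all
    \<comment> \<open>For symmetric \<open>P\<close> the skew part of \<open>A3\<close> alone
      contributes 256.\<close>
    moreover have "0 \<le> (16 - p)\<^sup>2 + s\<^sup>2 + (16 + u)\<^sup>2 + 2 * q\<^sup>2 + 2 * r\<^sup>2 + 2 * t\<^sup>2"
      by (intro add_nonneg_nonneg) simp_all
    ultimately show ?thesis unfolding D by simp
  qed
qed

section \<open>Embedding size 3 into larger sizes\<close>

text \<open>For injective \<open>e\<close> this is the direct sum of \<open>B\<close> and T I, up to
  a permutation of indices. The map \<open>e\<close> selects the place of \<open>B\<close>, since an
  arbitrary index type has no distinguished elements.\<close>

definition block :: "('k \<Rightarrow> 'n) \<Rightarrow> 'a \<Rightarrow> 'a ^ 'k ^ 'k \<Rightarrow> 'a::zero ^ 'n ^ 'n" where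
  "block e T B = (\<chi> i j. if i \<in> range e \<and> j \<in> range e then B $ inv e i $ inv e j
                        else if i = j then T else 0)"

definition compress :: "('k \<Rightarrow> 'n) \<Rightarrow> 'a ^ 'n ^ 'n \<Rightarrow> 'a ^ 'k ^ 'k" where
  "compress e P = (\<chi> i j. P $ e i $ e j)"

lemma block_inside: "inj e \<Longrightarrow> block e T B $ e i $ e j = B $ i $ j"
  by (simp add: block_def)

lemma block_outside: "i \<notin> range e \<or> j \<notin> range e \<Longrightarrow> block e T B $ i $ j = (if i = j then T else 0)"
  by (auto simp: block_def)

lemma compress_block: "inj e \<Longrightarrow> compress e (block e T B) = B"
  by (simp add: compress_def block_inside vec_eq_iff)

lemma compress_diff: "compress e (P - Q) = compress e P - compress e Q"
  by (simp add: compress_def vec_eq_iff)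

lemma sum_range_split:
  fixes e :: "'k::finite \<Rightarrow> 'n::finite" and f :: "'n \<Rightarrow> 'a::comm_monoid_add"
  assumes "inj e"
  shows "sum f UNIV = (\<Sum>k\<in>UNIV. f (e k)) + sum f (- range e)"
proof -
  have "sum f UNIV = sum f (range e) + sum f (- range e)"
    by (metis sum.subset_diff Compl_eq_Diff_UNIV finite_class.finite_UNIV subset_UNIV add.commute)
  then show ?thesis by (simp add: sum.reindex[OF assms])
qed

text \<open>Direct sums multiply blockwise; with \<open>conj_transpose_block\<close> this transfers
  normality from \<open>B\<close> to \<open>block e T B\<close>.\<close>

lemma block_mult:
  fixes e :: "'k::finite \<Rightarrow> 'n::finite" and B B' :: "'a::semiring_1 ^ 'k ^ 'k"
  assumes "inj e"
  shows "block e T B ** block e T' B' = block e (T * T') (B ** B')"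
proof -
  have "(block e T B ** block e T' B') $ i $ j = block e (T * T') (B ** B') $ i $ j" for i j
  proof -
    have "(block e T B ** block e T' B') $ i $ j
      = (\<Sum>k\<in>UNIV. block e T B $ i $ e k * block e T' B' $ e k $ j)
        + (\<Sum>k\<in>- range e. block e T B $ i $ k * block e T' B' $ k $ j)"
      by (simp add: matrix_matrix_mult_def sum_range_split[OF assms])
    also have "\<dots> = block e (T * T') (B ** B') $ i $ j"
    proof (cases "i \<in> range e")
      case True
      then obtain i' where i: "i = e i'" by blast
      have "(\<Sum>k\<in>- range e. block e T B $ i $ k * block e T' B' $ k $ j) = 0"
        by (intro sum.neutral) (auto simp: i block_outside)
      moreover have "(\<Sum>k\<in>UNIV. block e T B $ i $ e k * block e T' B' $ e k $ j)
          = block e (T * T') (B ** B') $ i $ j"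
      proof (cases "j \<in> range e")
        case True
        then show ?thesis by (auto simp: i block_inside[OF assms] matrix_matrix_mult_def)
      next
        case False
        then show ?thesis by (auto simp: block_outside i intro!: sum.neutral)
      qed
      ultimately show ?thesis by simp
    next
      case False
      then have "(\<Sum>k\<in>UNIV. block e T B $ i $ e k * block e T' B' $ e k $ j) = 0"
        by (intro sum.neutral) (auto simp: block_outside)
      moreover have "(\<Sum>k\<in>- range e. block e T B $ i $ k * block e T' B' $ k $ j)
          = (\<Sum>k\<in>- range e. if i = k then T * (if i = j then T' else 0) else 0)"
        using False by (intro sum.cong) (auto simp: block_outside)
      moreover have "\<dots> = block e (T * T') (B ** B') $ i $ j"
        using False by (simp add: block_outside)
      ultimately show ?thesis by simp
    qed
    finally show ?thesis .
  qed
  then show ?thesis by (simp add: vec_eq_iff)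
qed

lemma conj_transpose_block: "conj_transpose (block e T B) = block e (cnj T) (conj_transpose B)"
  by (auto simp: conj_transpose_def block_def map_matrix_def transpose_def vec_eq_iff)

lemma normal_matrix_block:
  fixes e :: "'k::finite \<Rightarrow> 'n::finite"
  assumes "inj e" "normal_matrix B"
  shows "normal_matrix (block e T B)"
  using assms by (simp add: normal_matrix_def conj_transpose_block block_mult mult.commute)

lemma map_matrix_block: "f 0 = 0 \<Longrightarrow> map_matrix f (block e T B) = block e (f T) (map_matrix f B)"
  by (auto simp: block_def map_matrix_def vec_eq_iff)

text \<open>The scalar parts cancel, so the complex competitor stays at squared distance 242 however
  large \<open>T\<close> is.\<close>

lemma norm_block_diff:
  fixes e :: "'k::finite \<Rightarrow> 'n::finite" and B :: "'a::real_normed_vector ^ 'k ^ 'k"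
  assumes "inj e"
  shows "norm (block e T B - block e T B') = norm (B - B')"
proof -
  have "(norm (block e T B - block e T B'))\<^sup>2 = (norm (B - B'))\<^sup>2"
    by (simp add: norm_square_matrix sum_range_split[OF assms] block_inside[OF assms] block_outside)
  then show ?thesis by simp
qed

lemma norm_compress_le:
  fixes e :: "'k::finite \<Rightarrow> 'n::finite" and P :: "'a::real_normed_vector ^ 'n ^ 'n"
  assumes "inj e"
  shows "norm (compress e P) \<le> norm P"
proof -
  have "(norm (compress e P))\<^sup>2 \<le> (norm P)\<^sup>2"
    by (simp add: norm_square_matrix sum_range_split[OF assms] compress_def sum.distrib sum_nonneg)
  then show ?thesis by (rule power2_le_imp_le) simp
qed

section \<open>Real normal matrices near a block matrix with growing scalar part\<close>

lemma norm_nth_nth_le: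
  fixes M :: "'a::real_normed_vector ^ 'n ^ 'm"
  shows "norm (M $ i $ j) \<le> norm M"
  by (meson Finite_Cartesian_Product.norm_nth_le order_trans)

text \<open>In the entry (i,k) of P P^T - P^T P, the summation index k contributes (P_ik - P_ki)
  P_kk. Here P_kk grows with m while all other contributions stay bounded, so the first factor must
  tend to zero.\<close>

lemma normal_near_block_offdiag:
  fixes e :: "'k::finite \<Rightarrow> 'n::finite" and P :: "nat \<Rightarrow> real ^ 'n ^ 'n"
  assumes e: "inj e"
    and normal: "\<And>m. P m ** transpose (P m) = transpose (P m) ** P m"
    and near: "\<And>m. norm (block e (real m) B - P m) \<le> K"
    and i: "i \<in> range e" and k: "k \<notin> range e"
  shows "(\<lambda>m. P m $ i $ k - P m $ k $ i) \<longlonglongrightarrow> 0"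
proof -
  define M where "M = norm B + K"
  have ent: "\<bar>block e (real m) B $ x $ y - P m $ x $ y\<bar> \<le> K" for m x y
    using norm_nth_nth_le[of "block e (real m) B - P m" x y] near[of m] by simp
  have K: "K \<ge> 0" using norm_ge_zero near[of 0] by (rule order_trans)
  \<comment> \<open>Only diagonal entries outside the range of \<open>e\<close> can grow with
    m.\<close>
  have bd: "\<bar>P m $ x $ y\<bar> \<le> M" if "x \<noteq> y \<or> x \<in> range e" for m x y
  proof -
    have "\<bar>block e (real m) B $ x $ y\<bar> \<le> norm B"
      using that norm_nth_nth_le[of B] by (auto simp: block_def)
    then show ?thesis using ent[of m x y] by (simp add: M_def)
  qed
  define C where "C = real CARD('n) * (2 * M\<^sup>2)"
  have M: "M \<ge> 0" using K by (simp add: M_def)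
  \<comment> \<open>The product form is valid also for m \<le> K; division waits until m >
    K.\<close>
  have key: "\<bar>P m $ i $ k - P m $ k $ i\<bar> * (real m - K) \<le> C" for m
  proof -
    let ?P = "P m"
    have "(?P ** transpose ?P) $ i $ k = (transpose ?P ** ?P) $ i $ k"
      using normal by simp
    then have "(\<Sum>l\<in>UNIV. ?P $ i $ l * ?P $ k $ l - ?P $ l $ i * ?P $ l $ k) = 0"
      by (simp add: matrix_matrix_mult_def transpose_def sum_subtractf)
    then have "(?P $ i $ k - ?P $ k $ i) * ?P $ k $ k
        = - (\<Sum>l\<in>UNIV - {k}. ?P $ i $ l * ?P $ k $ l - ?P $ l $ i * ?P $ l $ k)"
      by (subst (asm) sum.remove[of _ k]) (simp_all add: algebra_simps)
    then have "\<bar>(?P $ i $ k - ?P $ k $ i) * ?P $ k $ k\<bar>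
        = \<bar>\<Sum>l\<in>UNIV - {k}. ?P $ i $ l * ?P $ k $ l - ?P $ l $ i * ?P $ l $ k\<bar>"
      by simp
    also have "\<dots> \<le> (\<Sum>l\<in>UNIV - {k}. 2 * M\<^sup>2)"
    proof (rule order_trans[OF sum_abs sum_mono])
      fix l assume "l \<in> UNIV - {k}"
      \<comment> \<open>As l differs from k and i lies in the range of \<open>e\<close>, none of
        these four is a growing diagonal entry.\<close>
      then have "\<bar>?P $ i $ l\<bar> \<le> M" "\<bar>?P $ k $ l\<bar> \<le> M" "\<bar>?P $ l $ i\<bar> \<le> M" "\<bar>?P $ l $ k\<bar> \<le> M"
        using i by (auto intro!: bd)
      then have "\<bar>?P $ i $ l * ?P $ k $ l\<bar> \<le> M * M" "\<bar>?P $ l $ i * ?P $ l $ k\<bar> \<le> M * M"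
        unfolding abs_mult by (auto intro!: mult_mono M)
      then show "\<bar>?P $ i $ l * ?P $ k $ l - ?P $ l $ i * ?P $ l $ k\<bar> \<le> 2 * M\<^sup>2"
        by (simp add: power2_eq_square)
    qed
    also have "\<dots> \<le> C"
      unfolding sum_constant C_def by (intro mult_right_mono) (simp_all add: card_Diff_singleton)
    finally have "\<bar>?P $ i $ k - ?P $ k $ i\<bar> * \<bar>?P $ k $ k\<bar> \<le> C"
      by (simp add: abs_mult)
    moreover have "real m - K \<le> \<bar>?P $ k $ k\<bar>"
      using ent[of m k k] k by (simp add: block_outside)
    then have "\<bar>?P $ i $ k - ?P $ k $ i\<bar> * (real m - K) \<le> \<bar>?P $ i $ k - ?P $ k $ i\<bar> * \<bar>?P $ k $ k\<bar>"
      by (rule mult_left_mono) simp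
    ultimately show ?thesis by (rule order_trans[rotated])
  qed
  have "filterlim (\<lambda>m. - K + real m) at_top sequentially"
    by (rule filterlim_tendsto_add_at_top[OF tendsto_const filterlim_real_sequentially])
  then have lim: "filterlim (\<lambda>m. real m - K) at_top sequentially" by simp
  have "(\<lambda>m. C / (real m - K)) \<longlonglongrightarrow> 0"
    by (rule tendsto_divide_0[OF tendsto_const filterlim_at_top_imp_at_infinity[OF lim]])
  moreover have "\<forall>\<^sub>F m in sequentially. 0 < real m - K"
    using lim by (simp only: filterlim_at_top_dense)
  then have "\<forall>\<^sub>F m in sequentially. norm (P m $ i $ k - P m $ k $ i) \<le> C / (real m - K)"
    by eventually_elim (simp only: real_norm_def pos_le_divide_eq key)
  ultimately show ?thesis by (rule Lim_null_comparison[rotated])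
qed

text \<open>The full commutator vanishes, so that of the compression is minus the contribution of
  the indices outside the range of \<open>e\<close>. There mirrored entries merge in the limit and
  off-diagonal entries are bounded.\<close>

lemma compress_near_block_normal:
  fixes e :: "'k::finite \<Rightarrow> 'n::finite" and P :: "nat \<Rightarrow> real ^ 'n ^ 'n"
  assumes e: "inj e"
    and normal: "\<And>m. P m ** transpose (P m) = transpose (P m) ** P m"
    and near: "\<And>m. norm (block e (real m) B - P m) \<le> K"
  shows "(\<lambda>m. (compress e (P m) ** transpose (compress e (P m))
            - transpose (compress e (P m)) ** compress e (P m)) $ i $ j) \<longlonglongrightarrow> 0"
proof -
  let ?f = "\<lambda>k m. P m $ e i $ k * P m $ e j $ k - P m $ k $ e i * P m $ k $ e j"
  have "(\<lambda>m. ?f k m) \<longlonglongrightarrow> 0" if k: "k \<in> - range e" for k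
  proof -
    have ent: "\<bar>P m $ x $ y\<bar> \<le> K" if "x \<noteq> y" "x \<notin> range e \<or> y \<notin> range e" for m x y
      using norm_nth_nth_le[of "block e (real m) B - P m" x y] near[of m] that
      by (simp add: block_outside)
    have "(\<lambda>m. P m $ e l $ k - P m $ k $ e l) \<longlonglongrightarrow> 0" for l
      by (rule normal_near_block_offdiag[OF e normal near]) (use k in auto)
    then have lim: "(\<lambda>m. K * (\<bar>P m $ e j $ k - P m $ k $ e j\<bar> + \<bar>P m $ e i $ k - P m $ k $ e i\<bar>)) \<longlonglongrightarrow> 0"
      by (intro tendsto_mult_right_zero tendsto_add_zero tendsto_rabs_zero)
    have bound: "norm (?f k m) \<le> K * (\<bar>P m $ e j $ k - P m $ k $ e j\<bar> + \<bar>P m $ e i $ k - P m $ k $ e i\<bar>)"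
      for m
    proof -
      \<comment> \<open>The splitting puts one vanishing difference into each summand.\<close>
      have "?f k m = P m $ e i $ k * (P m $ e j $ k - P m $ k $ e j)
          + P m $ k $ e j * (P m $ e i $ k - P m $ k $ e i)"
        by (simp add: algebra_simps)
      also have "norm \<dots> \<le> \<bar>P m $ e i $ k\<bar> * \<bar>P m $ e j $ k - P m $ k $ e j\<bar>
          + \<bar>P m $ k $ e j\<bar> * \<bar>P m $ e i $ k - P m $ k $ e i\<bar>"
        unfolding real_norm_def abs_mult[symmetric] by (rule abs_triangle_ineq)
      also have "\<dots> \<le> K * \<bar>P m $ e j $ k - P m $ k $ e j\<bar> + K * \<bar>P m $ e i $ k - P m $ k $ e i\<bar>"
        using k by (intro add_mono mult_right_mono ent) auto
      finally show ?thesis by (simp add: algebra_simps)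
    qed
    show ?thesis
      by (rule Lim_null_comparison[OF always_eventually lim]) (use bound in blast)
  qed
  then have "(\<lambda>m. - (\<Sum>k\<in>- range e. ?f k m)) \<longlonglongrightarrow> - 0"
    by (intro tendsto_minus tendsto_null_sum)
  moreover have "(compress e (P m) ** transpose (compress e (P m))
            - transpose (compress e (P m)) ** compress e (P m)) $ i $ j = - (\<Sum>k\<in>- range e. ?f k m)" for m
  proof -
    have "(P m ** transpose (P m)) $ e i $ e j = (transpose (P m) ** P m) $ e i $ e j"
      using normal by simp
    then have "(\<Sum>k\<in>UNIV. ?f k m) = 0"
      by (simp add: matrix_matrix_mult_def transpose_def sum_subtractf)
    then have "(\<Sum>k\<in>UNIV. ?f (e k) m) = - (\<Sum>k\<in>- range e. ?f k m)"
      unfolding sum_range_split[OF e] by linarith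
    then show ?thesis
      by (simp add: matrix_matrix_mult_def transpose_def compress_def sum_subtractf)
  qed
  ultimately show ?thesis by simp
qed

text \<open>The threshold 244 is chosen between 242 and 736/3.\<close>

lemma dist_block_A3_real_normal:
  fixes e :: "3 \<Rightarrow> 'n::finite"
  assumes e: "inj e"
  obtains T :: real where "\<And>P :: real ^ 'n ^ 'n. P ** transpose P = transpose P ** P \<Longrightarrow>
     244 < (norm (block e T A3 - P))\<^sup>2"
proof (rule ccontr)
  assume "\<not> thesis"
  then have "\<forall>m. \<exists>P :: real ^ 'n ^ 'n. P ** transpose P = transpose P ** P \<and>
      (norm (block e (real m) A3 - P))\<^sup>2 \<le> 244"
    using that by (meson not_le)
  then obtain P :: "nat \<Rightarrow> real ^ 'n ^ 'n" where normal: "\<And>m. P m ** transpose (P m) = transpose (P m) ** P m"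
    and "\<And>m. (norm (block e (real m) A3 - P m))\<^sup>2 \<le> 244"
    by metis
  then have near: "norm (block e (real m) A3 - P m) \<le> sqrt 244" for m
    by (simp add: real_le_rsqrt)
  define Q where "Q m = compress e (P m)" for m
  have "norm (A3 - Q m) \<le> sqrt 244" for m
    using norm_compress_le[OF e, of "block e (real m) A3 - P m"] near[of m]
    by (simp add: compress_diff compress_block[OF e] Q_def)
  then have "Q m \<in> cball A3 (sqrt 244)" for m
    by (simp add: dist_norm)
  \<comment> \<open>The compressions stay in a compact ball; the limit of a convergent subsequence
    is normal and too close to \<open>A3\<close>.\<close>
  then obtain L r where L: "L \<in> cball A3 (sqrt 244)" and r: "strict_mono r" "(Q \<circ> r) \<longlonglongrightarrow> L"
    using compact_cball[of A3 "sqrt 244", unfolded compact_def] by metis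
  have "(L ** transpose L - transpose L ** L) $ i $ j = 0" for i j
  proof (rule LIMSEQ_unique)
    have "(\<lambda>m. Q (r m)) \<longlonglongrightarrow> L"
      using r(2) by (simp add: o_def)
    then show "(\<lambda>m. (Q (r m) ** transpose (Q (r m)) - transpose (Q (r m)) ** Q (r m)) $ i $ j)
        \<longlonglongrightarrow> (L ** transpose L - transpose L ** L) $ i $ j"
      unfolding matrix_matrix_mult_def transpose_def by (simp, intro tendsto_intros)
    show "(\<lambda>m. (Q (r m) ** transpose (Q (r m)) - transpose (Q (r m)) ** Q (r m)) $ i $ j) \<longlonglongrightarrow> 0"
      using LIMSEQ_subseq_LIMSEQ[OF compress_near_block_normal[OF e normal near] r(1)]
      by (simp add: Q_def o_def)
  qed
  then have "L ** transpose L = transpose L ** L"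
    by (simp add: vec_eq_iff)
  then have "736/3 \<le> (norm (A3 - L))\<^sup>2" by (rule dist_A3_real_normal)
  moreover have "(norm (A3 - L))\<^sup>2 \<le> (sqrt 244)\<^sup>2"
    using L by (intro power_mono) (simp_all add: dist_norm)
  ultimately show False by simp
qed

section \<open>Passing between real and complex matrices, and the cone\<close>

lemma norm_map_matrix_of_real: "norm (map_matrix complex_of_real A) = norm A"
proof -
  have "(norm (map_matrix complex_of_real A))\<^sup>2 = (norm A)\<^sup>2"
    by (simp add: norm_square_matrix map_matrix_def)
  then show ?thesis by simp
qed

lemma map_matrix_of_real_diff:
  "map_matrix complex_of_real A - map_matrix complex_of_real B = map_matrix complex_of_real (A - B)"
  by (simp add: map_matrix_def vec_eq_iff)

lemma real_normal_matrixE: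
  assumes "normal_matrix N" "real_matrix N"
  obtains P where "N = map_matrix complex_of_real P" "P ** transpose P = transpose P ** P"
proof
  define P where "P = map_matrix Re N"
  show N: "N = map_matrix complex_of_real P"
    using assms(2) by (simp add: P_def real_matrix_def map_matrix_def vec_eq_iff)
  have "complex_of_real ((P ** transpose P) $ i $ j) = complex_of_real ((transpose P ** P) $ i $ j)" for i j
  proof -
    have "(N ** conj_transpose N) $ i $ j = (conj_transpose N ** N) $ i $ j"
      using assms(1) by (simp add: normal_matrix_def)
    then show ?thesis
      by (simp add: N conj_transpose_def map_matrix_def transpose_def matrix_matrix_mult_def)
  qed
  then show "P ** transpose P = transpose P ** P"
    by (simp add: vec_eq_iff)
qed

theorem corollary3p6:
  assumes "CARD('n::finite) \<ge> 3"
  shows "\<exists>C :: (real ^ 'n ^ 'n) set. open C \<and> C \<noteq> {} \<and> positive_cone C \<and>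
           (\<forall>A\<in>C. \<forall>N. nearest_normal_matrix (map_matrix complex_of_real A) N \<longrightarrow> \<not> real_matrix N)"
proof -
  let ?c = "map_matrix complex_of_real"
  \<comment> \<open>Membership asks for a threshold \<open>d\<close> separating one complex normal
    matrix from all real ones. This avoids minimisers, and the gap below \<open>d\<close> leaves
    room for perturbations.\<close>
  define C :: "(real ^ 'n ^ 'n) set" where "C = {A. \<exists>M d. normal_matrix M \<and> norm (?c A - M) < d \<and>
    (\<forall>P. P ** transpose P = transpose P ** P \<longrightarrow> d \<le> norm (A - P))}"
  have "open C"
    unfolding open_dist
  proof
    fix A assume "A \<in> C"
    then obtain M d where M: "normal_matrix M" "norm (?c A - M) < d"
      and d: "\<And>P. P ** transpose P = transpose P ** P \<Longrightarrow> d \<le> norm (A - P)"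
      unfolding C_def by blast
    \<comment> \<open>Half the gap: each distance changes by less than \<delta>, so
      \<open>d - \<delta>\<close> separates for \<open>A'\<close>.\<close>
    define \<delta> where "\<delta> = (d - norm (?c A - M)) / 2"
    have "A' \<in> C" if "dist A' A < \<delta>" for A'
    proof -
      have "norm (?c A' - ?c A) < \<delta>"
        using that by (simp add: map_matrix_of_real_diff norm_map_matrix_of_real dist_norm)
      then have "norm (?c A' - M) < d - \<delta>"
        using norm_triangle_ineq[of "?c A' - ?c A" "?c A - M"] by (simp add: \<delta>_def field_simps)
      moreover have "d - \<delta> \<le> norm (A' - P)" if "P ** transpose P = transpose P ** P" for P
        using d[OF that] norm_triangle_ineq[of "A - A'" "A' - P"] \<open>dist A' A < \<delta>\<close>
        by (simp add: dist_norm norm_minus_commute)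
      ultimately show ?thesis unfolding C_def using M(1) by blast
    qed
    moreover have "\<delta> > 0" using M(2) by (simp add: \<delta>_def)
    ultimately show "\<exists>\<delta>>0. \<forall>A'. dist A' A < \<delta> \<longrightarrow> A' \<in> C" by blast
  qed
  moreover have "C \<noteq> {}"
  proof -
    obtain e :: "3 \<Rightarrow> 'n" where e: "inj e"
      using card_le_inj[of "UNIV :: 3 set" "UNIV :: 'n set"] assms by auto
    obtain T where T: "\<And>P :: real ^ 'n ^ 'n. P ** transpose P = transpose P ** P \<Longrightarrow>
        244 < (norm (block e T A3 - P))\<^sup>2"
      using dist_block_A3_real_normal[OF e] by blast
    have "normal_matrix (block e (complex_of_real T) N3)"
      by (rule normal_matrix_block[OF e normal_N3])
    moreover have "norm (?c (block e T A3) - block e (complex_of_real T) N3) = sqrt 242"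
      by (simp add: map_matrix_block norm_block_diff[OF e] flip: dist_A3_N3)
    then have "norm (?c (block e T A3) - block e (complex_of_real T) N3) < sqrt 244"
      by simp
    moreover have "sqrt 244 \<le> norm (block e T A3 - P)" if "P ** transpose P = transpose P ** P" for P
      using T[OF that] by (simp add: real_le_lsqrt)
    ultimately have "block e T A3 \<in> C" unfolding C_def by blast
    then show ?thesis by blast
  qed
  moreover have "positive_cone C"
  proof -
    have scale: "t *\<^sub>R A \<in> C" if t: "t > 0" and A: "A \<in> C" for t A
    proof -
      obtain M d where M: "normal_matrix M" "norm (?c A - M) < d"
        and d: "\<And>P. P ** transpose P = transpose P ** P \<Longrightarrow> d \<le> norm (A - P)"
        using A unfolding C_def by blast
      have "normal_matrix (t *\<^sub>R M)"
        using M(1) by (simp add: normal_matrix_def conj_transpose_def map_matrix_def transpose_def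
            matrix_matrix_mult_def vec_eq_iff flip: scaleR_sum_right)
      moreover have "?c (t *\<^sub>R A) - t *\<^sub>R M = t *\<^sub>R (?c A - M)"
        by (simp add: map_matrix_def vec_eq_iff scaleR_conv_of_real[where 'a = complex] right_diff_distrib)
      then have "norm (?c (t *\<^sub>R A) - t *\<^sub>R M) < t * d"
        using M(2) t by simp
      moreover have "t * d \<le> norm (t *\<^sub>R A - P)" if P: "P ** transpose P = transpose P ** P" for P
      proof -
        \<comment> \<open>Normality is invariant under scaling, so dividing by \<open>t\<close>
          reduces to the bound for \<open>A\<close>.\<close>
        let ?Q = "inverse t *\<^sub>R P"
        have "?Q ** transpose ?Q = transpose ?Q ** ?Q"
          using P by (simp add: matrix_scalar_ac transpose_scalar flip: scalar_matrix_assoc)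
        then have "t * d \<le> t * norm (A - ?Q)"
          using d t by simp
        also have "\<dots> = norm (t *\<^sub>R (A - ?Q))" using t by simp
        also have "t *\<^sub>R (A - ?Q) = t *\<^sub>R A - P" using t by (simp add: scaleR_diff_right)
        finally show ?thesis .
      qed
      ultimately show ?thesis unfolding C_def by blast
    qed
    have "(\<lambda>A. t *\<^sub>R A) ` C = C" if t: "t > 0" for t
    proof
      show "(\<lambda>A. t *\<^sub>R A) ` C \<subseteq> C" using scale[OF t] by blast
      have "A = t *\<^sub>R (inverse t *\<^sub>R A)" for A :: "real ^ 'n ^ 'n" using t by simp
      moreover have "inverse t *\<^sub>R A \<in> C" if "A \<in> C" for A using scale[of "inverse t" A] t that by simp
      ultimately show "C \<subseteq> (\<lambda>A. t *\<^sub>R A) ` C" by blast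
    qed
    then show ?thesis by (simp add: positive_cone_def)
  qed
  moreover have "\<not> real_matrix N" if A: "A \<in> C" and N: "nearest_normal_matrix (?c A) N" for A N
  proof
    assume "real_matrix N"
    moreover have normal: "normal_matrix N"
      and min: "\<And>M. normal_matrix M \<Longrightarrow> norm (?c A - N) \<le> norm (?c A - M)"
      using N by (auto simp: nearest_normal_matrix_def is_arg_min_def frobenius_norm_eq_norm not_less)
    ultimately obtain P where P: "N = ?c P" "P ** transpose P = transpose P ** P"
      by (metis real_normal_matrixE)
    obtain M d where M: "normal_matrix M" "norm (?c A - M) < d" and "d \<le> norm (A - P)"
      using A P(2) unfolding C_def by blast
    then have "norm (?c A - M) < norm (?c A - N)"
      by (simp add: P(1) map_matrix_of_real_diff norm_map_matrix_of_real)
    then show False using min[OF M(1)] by simp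
  qed
  ultimately show ?thesis by blast
qed

end
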